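(* There exists a language which is context-free and definable in Presburger arithmetic, yet does not have subexponential alternating online state complexity, i.e. it is not in $\mathrm{Alt}(f)$ for any $f:\mathbb{N}\to\mathbb{N}$ satisfying $f = o(C^n)$ for all $C>1$.
   Context: An alternating machine over a finite alphabet $A$ consists of a (possibly infinite) set of states $Q$, an initial state $q_0\in Q$, a transition function $\delta: Q\times A\to\mathcal{B}^+(Q)$ (positive boolean formulae over $Q$) and a set $F\subseteq Q$ of accepting states. For an input word $w$, the acceptance game $\mathcal{G}_{\mathcal{A},w}$ is played by Prover and Verifier: starting in $q_0$, the letters of $w$ are read from left to right; in state $q$ reading letter $a$, the next state is obtained from the formula $\delta(q,a)$, Prover resolving disjunctions and Verifier resolving conjunctions. Prover wins a play if it ends in a state of $F$. The word $w$ is accepted if Prover has a winning strategy; the language recognised is the set of accepted words. For $f:\mathbb{N}\to\mathbb{N}$, a language $L$ is in $\mathrm{Alt}(f)$ if there are an alternating machine recognising $L$ and a constant $C$ such that for all $n\in\mathbb{N}$, the number of states $q$ for which there exists a word $w$ of length at most $n$ with $q$ appearing in the game $\mathcal{G}_{\mathcal{A},w}$ is at most $C\cdot f(n)$. *)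

theory Defs
  imports Complex_Main "HOL-Library.Landau_Symbols" "HOL-Library.Countable_Set"
begin

section \<open>Alternating machines\<close>

text \<open>Positive boolean formulae are built from states with binary conjunction and disjunction only.
  There are no constants for truth and falsity, so every complete play ends in a state.\<close>

datatype (atoms: 'q) pbf = Atom 'q | And "'q pbf" "'q pbf" | Or "'q pbf" "'q pbf"

record ('q, 'a) alt_machine =
  states :: "'q set"
  init :: 'q
  delta :: "'q \<Rightarrow> 'a \<Rightarrow> 'q pbf"
  final :: "'q set"

definition alternating_machine :: "'a set \<Rightarrow> ('q, 'a) alt_machine \<Rightarrow> bool" where
  "alternating_machine A M \<longleftrightarrow>
     init M \<in> states M \<and> final M \<subseteq> states M \<and>
     (\<forall>q\<in>states M. \<forall>a\<in>A. atoms (delta M q a) \<subseteq> states M)"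

text \<open>A position of the acceptance game is a formula still to be resolved together with the part of
  the input still to be read; being in the state \<open>q\<close> is the position with formula \<open>Atom q\<close>.\<close>

type_synonym ('q, 'a) position = "'q pbf \<times> 'a list"

inductive move :: "('q, 'a) alt_machine \<Rightarrow> ('q, 'a) position \<Rightarrow> ('q, 'a) position \<Rightarrow> bool"
  for M where
  read: "move M (Atom q, a # w) (delta M q a, w)"
| AndL: "move M (And \<phi> \<psi>, w) (\<phi>, w)"
| AndR: "move M (And \<phi> \<psi>, w) (\<psi>, w)"
| OrL: "move M (Or \<phi> \<psi>, w) (\<phi>, w)"
| OrR: "move M (Or \<phi> \<psi>, w) (\<psi>, w)"

definition prover_turn :: "('q, 'a) position \<Rightarrow> bool" where
  "prover_turn p \<longleftrightarrow> (\<exists>\<phi> \<psi>. fst p = Or \<phi> \<psi>)"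

text \<open>Plays are the nonempty finite histories of positions, not necessarily complete.\<close>

inductive play :: "('q, 'a) alt_machine \<Rightarrow> 'a list \<Rightarrow> ('q, 'a) position list \<Rightarrow> bool"
  for M w where
  start: "play M w [(Atom (init M), w)]"
| step: "play M w h \<Longrightarrow> move M (last h) p \<Longrightarrow> play M w (h @ [p])"

text \<open>A strategy of Prover maps the history of the play to the next position.\<close>

type_synonym ('q, 'a) strategy = "('q, 'a) position list \<Rightarrow> ('q, 'a) position"

definition consistent :: "('q, 'a) strategy \<Rightarrow> ('q, 'a) position list \<Rightarrow> bool" where
  "consistent \<sigma> h \<longleftrightarrow>
     (\<forall>i. Suc i < length h \<longrightarrow> prover_turn (h ! i) \<longrightarrow> h ! Suc i = \<sigma> (take (Suc i) h))"

definition winning_strategy ::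
    "('q, 'a) alt_machine \<Rightarrow> 'a list \<Rightarrow> ('q, 'a) strategy \<Rightarrow> bool" where
  "winning_strategy M w \<sigma> \<longleftrightarrow>
     (\<forall>h. play M w h \<and> consistent \<sigma> h \<longrightarrow>
        (prover_turn (last h) \<longrightarrow> move M (last h) (\<sigma> h)) \<and>
        (\<forall>q. last h = (Atom q, []) \<longrightarrow> q \<in> final M))"

definition accepts :: "('q, 'a) alt_machine \<Rightarrow> 'a list \<Rightarrow> bool" where
  "accepts M w \<longleftrightarrow> (\<exists>\<sigma>. winning_strategy M w \<sigma>)"

definition language :: "'a set \<Rightarrow> ('q, 'a) alt_machine \<Rightarrow> 'a list set" where
  "language A M = {w \<in> lists A. accepts M w}"

definition appears :: "('q, 'a) alt_machine \<Rightarrow> 'a list \<Rightarrow> 'q \<Rightarrow> bool" where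
  "appears M w q \<longleftrightarrow> (\<exists>h v. play M w h \<and> (Atom q, v) \<in> set h)"

definition states_upto :: "'a set \<Rightarrow> ('q, 'a) alt_machine \<Rightarrow> nat \<Rightarrow> 'q set" where
  "states_upto A M n = {q. \<exists>w\<in>lists A. length w \<le> n \<and> appears M w q}"

definition states_bounded :: "'a set \<Rightarrow> ('q, 'a) alt_machine \<Rightarrow> (nat \<Rightarrow> nat) \<Rightarrow> bool" where
  "states_bounded A M f \<longleftrightarrow>
     (\<exists>C::real. \<forall>n. finite (states_upto A M n) \<and>
        real (card (states_upto A M n)) \<le> C * real (f n))"

text \<open>The states are taken to be natural numbers; the lemma \<open>machine_in_Alt\<close> below shows that
  machines with states of any other type do not recognise more languages within the same bound.\<close>

definition Alt :: "'a set \<Rightarrow> (nat \<Rightarrow> nat) \<Rightarrow> 'a list set set" where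
  "Alt A f = {L. \<exists>M :: (nat, 'a) alt_machine.
      alternating_machine A M \<and> language A M = L \<and> states_bounded A M f}"

lemma play_nonempty: "play M w h \<Longrightarrow> h \<noteq> []"
  by (induction rule: play.induct) auto

lemma consistent_snoc:
  assumes "h \<noteq> []"
  shows "consistent \<sigma> (h @ [p]) \<longleftrightarrow> consistent \<sigma> h \<and> (prover_turn (last h) \<longrightarrow> p = \<sigma> h)"
proof -
  obtain n where n: "length h = Suc n" using assms by (cases h) auto
  have l: "last h = h ! n" using assms n by (simp add: last_conv_nth)
  show ?thesis
    unfolding consistent_def l
    by (auto simp: n less_Suc_eq nth_append)
qed

lemma consistent_single: "consistent \<sigma> [p]"
  by (simp add: consistent_def)

lemma accepts_transfer:
  fixes X :: "('q, 'a) alt_machine" and Y :: "('r, 'a) alt_machine"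
    and t :: "('q, 'a) position \<Rightarrow> ('r, 'a) position" and t' :: "('r, 'a) position \<Rightarrow> ('q, 'a) position"
  assumes init: "(Atom (init X), w) \<in> I" "t (Atom (init X), w) = (Atom (init Y), w)"
    and closed: "\<And>p p'. p \<in> I \<Longrightarrow> move X p p' \<Longrightarrow> p' \<in> I"
    and inv: "\<And>p. p \<in> I \<Longrightarrow> t' (t p) = p"
    and mv: "\<And>p p'. p \<in> I \<Longrightarrow> move Y (t p) p' \<longleftrightarrow> (\<exists>p1. move X p p1 \<and> p' = t p1)"
    and turn: "\<And>p. p \<in> I \<Longrightarrow> prover_turn (t p) \<longleftrightarrow> prover_turn p"
    and fin: "\<And>p r. p \<in> I \<Longrightarrow> t p = (Atom r, []) \<Longrightarrow>
                \<exists>q. p = (Atom q, []) \<and> (q \<in> final X \<longrightarrow> r \<in> final Y)"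
    and acc: "accepts X w"
  shows "accepts Y w"
proof -
  obtain \<sigma> where \<sigma>: "winning_strategy X w \<sigma>" using acc by (auto simp: accepts_def)
  define \<tau> where "\<tau> k = t (\<sigma> (map t' k))" for k
  have lift: "\<exists>h. play X w h \<and> consistent \<sigma> h \<and> set h \<subseteq> I \<and> k = map t h"
    if "play Y w k" "consistent \<tau> k" for k
    using that
  proof (induction rule: play.induct)
    case start
    show ?case
      by (rule exI[of _ "[(Atom (init X), w)]"]) (auto simp: init consistent_single play.start)
  next
    case (step k p)
    have kne: "k \<noteq> []" using step.hyps(1) by (rule play_nonempty)
    obtain h where h: "play X w h" "consistent \<sigma> h" "set h \<subseteq> I" "k = map t h"
      using step consistent_snoc[OF kne, of \<tau> p] by blast
    have hne: "h \<noteq> []" using h(4) kne by simp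
    have lI: "last h \<in> I" using h(3) hne by auto
    have lk: "last k = t (last h)" using h(4) hne by (simp add: last_map)
    have hk: "map t' k = h" unfolding h(4) map_map by (rule map_idI) (use h(3) inv in auto)
    show ?case
    proof (cases "prover_turn (last h)")
      case True
      then have "p = t (\<sigma> h)"
        using step.prems consistent_snoc[OF kne, of \<tau> p] turn[OF lI] lk hk
        unfolding \<tau>_def[of k] by simp
      moreover have m: "move X (last h) (\<sigma> h)"
        using \<sigma> h True by (auto simp: winning_strategy_def)
      ultimately show ?thesis
        using h closed[OF lI m] play.step[OF h(1) m] consistent_snoc[OF hne, of \<sigma> "\<sigma> h"]
        by (intro exI[of _ "h @ [\<sigma> h]"]) auto
    next
      case False
      obtain p1 where m: "move X (last h) p1" "p = t p1"
        using mv[OF lI, of p] step.hyps(2) lk by auto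
      then show ?thesis
        using h False closed[OF lI m(1)] play.step[OF h(1) m(1)] consistent_snoc[OF hne, of \<sigma> p1]
        by (intro exI[of _ "h @ [p1]"]) auto
    qed
  qed
  have "winning_strategy Y w \<tau>"
    unfolding winning_strategy_def
  proof (intro allI impI conjI)
    fix k assume k: "play Y w k \<and> consistent \<tau> k"
    then obtain h where h: "play X w h" "consistent \<sigma> h" "set h \<subseteq> I" "k = map t h"
      using lift by blast
    have hne: "h \<noteq> []" using h(1) by (rule play_nonempty)
    have lI: "last h \<in> I" using h(3) hne by auto
    have lk: "last k = t (last h)" using h(4) hne by (simp add: last_map)
    have hk: "map t' k = h" unfolding h(4) map_map by (rule map_idI) (use h(3) inv in auto)
    show "move Y (last k) (\<tau> k)" if "prover_turn (last k)"
    proof -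
      have "prover_turn (last h)" using that lk turn[OF lI] by simp
      then have "move X (last h) (\<sigma> h)" using \<sigma> h by (auto simp: winning_strategy_def)
      then show ?thesis unfolding \<tau>_def[of k] hk lk using mv[OF lI] by blast
    qed
    show "r \<in> final Y" if e: "last k = (Atom r, [])" for r
    proof -
      obtain q where q: "last h = (Atom q, [])" "q \<in> final X \<longrightarrow> r \<in> final Y"
        using fin[OF lI, of r] e lk by auto
      then show ?thesis using \<sigma> h by (auto simp: winning_strategy_def)
    qed
  qed
  then show ?thesis by (auto simp: accepts_def)
qed

lemma play_atoms_appear:
  assumes "play M w h" "last h = (\<phi>, v)" "q \<in> atoms \<phi>"
  shows "appears M w q"
  using assms
proof (induction \<phi> arbitrary: h)
  case (Atom x)
  then have "(Atom q, v) \<in> set h"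
    using play_nonempty[OF Atom.prems(1)] last_in_set[of h] by auto
  then show ?case using Atom by (auto simp: appears_def)
next
  case (And \<phi> \<psi>)
  have "play M w (h @ [(\<phi>, v)])" "play M w (h @ [(\<psi>, v)])"
    using And.prems by (auto intro!: play.step move.intros)
  then show ?case using And by (auto)
next
  case (Or \<phi> \<psi>)
  have "play M w (h @ [(\<phi>, v)])" "play M w (h @ [(\<psi>, v)])"
    using Or.prems by (auto intro!: play.step move.intros)
  then show ?case using Or by (auto)
qed

lemma play_positions:
  assumes "play M w h" "p \<in> set h"
  shows "\<exists>h'. play M w h' \<and> last h' = p"
  using assms
proof (induction rule: play.induct)
  case start
  then show ?case by (auto intro: exI[of _ "[(Atom (init M), w)]"] play.start)
next
  case (step h p')
  then show ?case by (auto intro: exI[of _ "h @ [p']"] play.step)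
qed

lemma machine_in_Alt:
  fixes M :: "('q, 'a) alt_machine"
  assumes M: "alternating_machine A M" and bnd: "states_bounded A M f"
  shows "language A M \<in> Alt A f"
proof -
  define R where "R = (\<Union>n. states_upto A M n)"
  have R_iff: "q \<in> R \<longleftrightarrow> (\<exists>w\<in>lists A. appears M w q)" for q
    by (auto simp: R_def states_upto_def)
  have "countable R"
    unfolding R_def using bnd by (intro countable_UN) (auto simp: states_bounded_def countable_finite)
  define g where "g = to_nat_on R"
  define g' where "g' = from_nat_into R"
  have gg: "g' (g q) = q" if "q \<in> R" for q
    using that \<open>countable R\<close> by (simp add: g_def g'_def)
  define N :: "(nat, 'a) alt_machine" where
    "N = \<lparr>states = UNIV, init = g (init M), delta = (\<lambda>n a. map_pbf g (delta M (g' n) a)),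
          final = g ` (final M \<inter> R)\<rparr>"
  define t :: "('q, 'a) position \<Rightarrow> (nat, 'a) position" where "t = map_prod (map_pbf g) id"
  define t' :: "(nat, 'a) position \<Rightarrow> ('q, 'a) position" where "t' = map_prod (map_pbf g') id"
  have tt: "t' (t p) = p" if "atoms (fst p) \<subseteq> R" for p
  proof -
    have "map_pbf g' (map_pbf g \<phi>) = \<phi>" if "atoms \<phi> \<subseteq> R" for \<phi>
      using that gg by (induction \<phi>) auto
    then show ?thesis using that by (cases p) (auto simp: t_def t'_def)
  qed
  have mv: "move N (t p) p' \<longleftrightarrow> (\<exists>p1. move M p p1 \<and> p' = t p1)" if "atoms (fst p) \<subseteq> R" for p p'
  proof -
    obtain \<phi> v where p: "p = (\<phi>, v)" by (cases p)
    show ?thesis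
      using that unfolding p t_def N_def
      by (cases \<phi>; cases v) (auto simp: move.simps gg)
  qed
  have turn: "prover_turn (t p) \<longleftrightarrow> prover_turn p" for p
    by (cases p; cases "fst p") (auto simp: prover_turn_def t_def)
  have trm: "t p = (Atom r, v) \<longleftrightarrow> (\<exists>q. p = (Atom q, v) \<and> r = g q)" for p r v
    by (cases p; cases "fst p") (auto simp: t_def)
  have finR: "g q \<in> final N \<longleftrightarrow> q \<in> final M" if "q \<in> R" for q
    using that gg by (auto simp: N_def) metis
  define I where "I w = {p. \<exists>h. play M w h \<and> last h = p}" for w
  have IR: "atoms (fst p) \<subseteq> R" if "p \<in> I w" "w \<in> lists A" for p w
    using that play_atoms_appear[of M w] R_iff by (cases p) (fastforce simp: I_def)
  have Iinit: "(Atom (init M), w) \<in> I w" for w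
    by (auto simp: I_def intro!: exI[of _ "[(Atom (init M), w)]"] play.start)
  have tinit: "t (Atom (init M), w) = (Atom (init N), w)" for w
    by (simp add: t_def N_def)
  have Icl: "p' \<in> I w" if p: "p \<in> I w" and m: "move M p p'" for p p' w
  proof -
    obtain h where h: "play M w h" "last h = p" using p unfolding I_def by blast
    then have "play M w (h @ [p'])" using m by (auto intro: play.step)
    then show ?thesis unfolding I_def by (auto intro!: exI[of _ "h @ [p']"])
  qed
  have IRv: "q \<in> R" if "(Atom q, v) \<in> I w" "w \<in> lists A" for q v w
    using IR[OF that] by simp
  have acc: "accepts N w \<longleftrightarrow> accepts M w" if w: "w \<in> lists A" for w
  proof
    assume "accepts M w"
    then show "accepts N w"
    proof (rule accepts_transfer[of M w "I w" t N t', rotated -1])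
      show "t' (t p) = p" if "p \<in> I w" for p using tt IR that w by blast
      show "move N (t p) p' \<longleftrightarrow> (\<exists>p1. move M p p1 \<and> p' = t p1)" if "p \<in> I w" for p p'
        using mv IR that w by blast
      show "\<exists>q. p = (Atom q, []) \<and> (q \<in> final M \<longrightarrow> r \<in> final N)"
        if "p \<in> I w" "t p = (Atom r, [])" for p r
        using that trm[of p r "[]"] finR IRv w by blast
      show "(Atom (init M), w) \<in> I w" by (rule Iinit)
      show "t (Atom (init M), w) = (Atom (init N), w)" by (rule tinit)
      show "p' \<in> I w" if "p \<in> I w" "move M p p'" for p p' using that by (rule Icl)
      show "prover_turn (t p) \<longleftrightarrow> prover_turn p" for p by (rule turn)
    qed
  next
    assume "accepts N w"
    then show "accepts M w"
    proof (rule accepts_transfer[of N w "t ` I w" t' M t, rotated -1])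
      show "(Atom (init N), w) \<in> t ` I w"
        using Iinit tinit by (metis imageI)
      show "t' (Atom (init N), w) = (Atom (init M), w)"
        using tt[OF IR[OF Iinit w]] tinit by simp
      show "p' \<in> t ` I w" if "p \<in> t ` I w" "move N p p'" for p p'
        using that mv IR w Icl by blast
      show "t (t' p) = p" if "p \<in> t ` I w" for p
        using that tt IR w by force
      show "move M (t' p) p' \<longleftrightarrow> (\<exists>p1. move N p p1 \<and> p' = t' p1)" if p: "p \<in> t ` I w" for p p'
      proof -
        obtain p0 where p0: "p0 \<in> I w" "p = t p0" using p by blast
        have e: "t' (t p1) = p1" if "p1 \<in> I w" for p1 using tt IR that w by blast
        have f: "t' (t p1) = p1" if "move M p0 p1" for p1 using e Icl[OF p0(1) that] .
        have "t' p = p0" using e p0 by simp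
        then have "move M (t' p) p' \<longleftrightarrow> (\<exists>p2. move M p0 p2 \<and> p' = t' (t p2))"
          by (metis f)
        also have "\<dots> \<longleftrightarrow> (\<exists>p1. move N p p1 \<and> p' = t' p1)"
          unfolding p0(2) mv[OF IR[OF p0(1) w]] by blast
        finally show ?thesis .
      qed
      show "prover_turn (t' p) \<longleftrightarrow> prover_turn p" if p: "p \<in> t ` I w" for p
      proof -
        obtain p0 where p0: "p0 \<in> I w" "p = t p0" using p by blast
        show ?thesis unfolding p0(2) tt[OF IR[OF p0(1) w]] turn ..
      qed
      show "\<exists>q. p = (Atom q, []) \<and> (q \<in> final N \<longrightarrow> r \<in> final M)"
        if p: "p \<in> t ` I w" "t' p = (Atom r, [])" for p r
      proof -
        obtain p0 where p0: "p0 \<in> I w" "p = t p0" using p by blast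
        have "p0 = (Atom r, [])" using p p0 tt[OF IR[OF p0(1) w]] by simp
        then show ?thesis using p0 trm finR IRv w by blast
      qed
    qed
  qed
  have plays: "\<exists>h. play M w h \<and> k = map t h" if "play N w k" and w: "w \<in> lists A" for w k
    using that(1)
  proof (induction rule: play.induct)
    case start
    show ?case
      by (rule exI[of _ "[(Atom (init M), w)]"]) (auto simp: tinit play.start)
  next
    case (step k p)
    obtain h where h: "play M w h" "k = map t h" using step by blast
    have "last k = t (last h)" using h play_nonempty[OF h(1)] by (simp add: last_map)
    moreover have "last h \<in> I w" using h by (auto simp: I_def)
    ultimately obtain p1 where "move M (last h) p1" "p = t p1"
      using mv[OF IR[OF _ w]] step.hyps(2) by metis
    then show ?case
      using h by (intro exI[of _ "h @ [p1]"]) (auto intro: play.step)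
  qed
  have app: "\<exists>q0. appears M w q0 \<and> q = g q0" if q: "appears N w q" and w: "w \<in> lists A" for w q
  proof -
    obtain k v where k: "play N w k" "(Atom q, v) \<in> set k" using q by (auto simp: appears_def)
    obtain h where h: "play M w h" "k = map t h" using plays[OF k(1) w] by blast
    obtain p where p: "p \<in> set h" "t p = (Atom q, v)" using h k by auto
    then show ?thesis using trm[of p q v] h by (auto simp: appears_def)
  qed
  have sub: "states_upto A N n \<subseteq> g ` states_upto A M n" for n
    using app by (fastforce simp: states_upto_def)
  obtain C :: real where C: "\<And>n. finite (states_upto A M n)"
      "\<And>n. real (card (states_upto A M n)) \<le> C * real (f n)"
    using bnd by (auto simp: states_bounded_def)
  have "states_bounded A N f"
    unfolding states_bounded_def
  proof (intro exI[of _ C] allI conjI)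
    fix n
    show "finite (states_upto A N n)" using finite_subset[OF sub] C by blast
    have "card (states_upto A N n) \<le> card (states_upto A M n)"
      using surj_card_le[OF C(1) sub] .
    then show "real (card (states_upto A N n)) \<le> C * real (f n)" using C(2)[of n] by linarith
  qed
  moreover have "alternating_machine A N"
    by (auto simp: alternating_machine_def N_def)
  moreover have "language A N = language A M"
    using acc by (auto simp: language_def)
  ultimately show ?thesis by (auto simp: Alt_def)
qed

section \<open>Context-free languages\<close>

datatype ('n, 't) symbol = NT 'n | T 't

inductive derives1 :: "('n \<times> ('n, 't) symbol list) set \<Rightarrow>
    ('n, 't) symbol list \<Rightarrow> ('n, 't) symbol list \<Rightarrow> bool" for P where
  "(X, \<alpha>) \<in> P \<Longrightarrow> derives1 P (u @ [NT X] @ v) (u @ \<alpha> @ v)"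

definition grammar_language ::
    "('n \<times> ('n, 't) symbol list) set \<Rightarrow> 'n \<Rightarrow> 't list set" where
  "grammar_language P S = {w. (derives1 P)\<^sup>*\<^sup>* [NT S] (map T w)}"

definition context_free :: "'a set \<Rightarrow> 'a list set \<Rightarrow> bool" where
  "context_free A L \<longleftrightarrow>
     (\<exists>(P :: (nat \<times> (nat, 'a) symbol list) set) S.
        finite P \<and> (\<forall>(X, \<alpha>)\<in>P. \<forall>a. T a \<in> set \<alpha> \<longrightarrow> a \<in> A) \<and> L = grammar_language P S)"

section \<open>Languages definable in Presburger arithmetic\<close>

text \<open>First-order logic over the positions \<open>{0..<length w}\<close> of a word \<open>w\<close>, with the letter
  predicates, the order and the graph of addition. Quantifiers range over positions only; a language
  definable in this sense is also definable by a formula over \<open>(\<nat>, +)\<close> with letter predicates,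
  by relativising the quantifiers to positions.\<close>

datatype 'a formula =
    Letter 'a nat
  | Eq nat nat
  | Less nat nat
  | Sum nat nat nat
  | Neg "'a formula"
  | Conj "'a formula" "'a formula"
  | Ex nat "'a formula"

fun holds :: "'a list \<Rightarrow> (nat \<Rightarrow> nat) \<Rightarrow> 'a formula \<Rightarrow> bool" where
  "holds w e (Letter a x) \<longleftrightarrow> e x < length w \<and> w ! e x = a"
| "holds w e (Eq x y) \<longleftrightarrow> e x = e y"
| "holds w e (Less x y) \<longleftrightarrow> e x < e y"
| "holds w e (Sum x y z) \<longleftrightarrow> e x + e y = e z"
| "holds w e (Neg \<phi>) \<longleftrightarrow> \<not> holds w e \<phi>"
| "holds w e (Conj \<phi> \<psi>) \<longleftrightarrow> holds w e \<phi> \<and> holds w e \<psi>"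
| "holds w e (Ex x \<phi>) \<longleftrightarrow> (\<exists>i<length w. holds w (e(x := i)) \<phi>)"

fun free_vars :: "'a formula \<Rightarrow> nat set" where
  "free_vars (Letter a x) = {x}"
| "free_vars (Eq x y) = {x, y}"
| "free_vars (Less x y) = {x, y}"
| "free_vars (Sum x y z) = {x, y, z}"
| "free_vars (Neg \<phi>) = free_vars \<phi>"
| "free_vars (Conj \<phi> \<psi>) = free_vars \<phi> \<union> free_vars \<psi>"
| "free_vars (Ex x \<phi>) = free_vars \<phi> - {x}"

text \<open>The value of a sentence does not depend on the assignment, here the constantly zero one.\<close>

definition presburger_definable :: "'a set \<Rightarrow> 'a list set \<Rightarrow> bool" where
  "presburger_definable A L \<longleftrightarrow>
     (\<exists>\<phi>. free_vars \<phi> = {} \<and> L = {w \<in> lists A. holds w (\<lambda>_. 0) \<phi>})"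

end

theory Submission
  imports Defs
begin

text \<open>
  The witness consists of the words \<open>u 2 x (rev u) 2 y\<close> with \<open>u\<close> over \<open>{0, 1}\<close>. Whether a machine
  accepts \<open>u @ w\<close> depends on \<open>w\<close> only through the set of those states reachable along \<open>u\<close> from which
  \<open>w\<close> is accepted. Every set \<open>U\<close> of binary words of length \<open>n\<close> is cut out by a single
  continuation \<open>w\<close>, which lists the reversals of the elements of \<open>U\<close>, so the subsets of
  \<open>{0, 1}\<^sup>n\<close> inject into the subsets of the states met on words of length at most \<open>n\<close>, and there are
  at least \<open>2\<^sup>n\<close> such states.
\<close>

section \<open>Denotational semantics of alternating machines\<close>

primrec pbf_sat :: "('q \<Rightarrow> bool) \<Rightarrow> 'q pbf \<Rightarrow> bool" where
  "pbf_sat V (Atom q) \<longleftrightarrow> V q"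
| "pbf_sat V (And \<phi> \<psi>) \<longleftrightarrow> pbf_sat V \<phi> \<and> pbf_sat V \<psi>"
| "pbf_sat V (Or \<phi> \<psi>) \<longleftrightarrow> pbf_sat V \<phi> \<or> pbf_sat V \<psi>"

primrec accepts_from :: "('q, 'a) alt_machine \<Rightarrow> 'a list \<Rightarrow> 'q \<Rightarrow> bool" where
  "accepts_from M [] q \<longleftrightarrow> q \<in> final M"
| "accepts_from M (a # w) q \<longleftrightarrow> pbf_sat (accepts_from M w) (delta M q a)"

text \<open>At \<open>And\<close> and \<open>Atom\<close> every extension of the play is consistent,
  and at \<open>Or\<close> the strategy picks a disjunct. Reading a letter replaces the state by a
  whole formula, so an induction on \<open>\<phi>\<close> is nested in one on
  \<open>v\<close>.\<close>

lemma winning_strategy_pbf_sat: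
  assumes \<sigma>: "winning_strategy M w \<sigma>"
    and "play M w h" "consistent \<sigma> h" "last h = (\<phi>, v)"
  shows "pbf_sat (accepts_from M v) \<phi>"
  using assms(2-)
proof (induction v arbitrary: \<phi> h)
  case Nil
  then show ?case
  proof (induction \<phi> arbitrary: h)
    case (Atom q)
    then show ?case using \<sigma> by (auto simp: winning_strategy_def)
  next
    case (And \<phi> \<psi>)
    have "consistent \<sigma> (h @ [p])" for p
      using And.prems consistent_snoc[OF play_nonempty[OF And.prems(1)]]
      by (auto simp: prover_turn_def)
    moreover have "play M w (h @ [(\<phi>, [])])" "play M w (h @ [(\<psi>, [])])"
      using And.prems by (auto intro!: play.step move.intros)
    ultimately show ?case using And.IH by auto
  next
    case (Or \<phi> \<psi>)
    have "move M (last h) (\<sigma> h)"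
      using \<sigma> Or.prems by (auto simp: winning_strategy_def prover_turn_def)
    moreover have "play M w (h @ [\<sigma> h])" using Or.prems calculation by (auto intro: play.step)
    moreover have "consistent \<sigma> (h @ [\<sigma> h])"
      using Or.prems consistent_snoc[OF play_nonempty[OF Or.prems(1)]] by auto
    ultimately show ?case using Or.IH[of "h @ [\<sigma> h]"] Or.prems(3) by (auto simp: move.simps)
  qed
next
  case (Cons a v)
  note outer = Cons.IH
  show ?case using Cons.prems
  proof (induction \<phi> arbitrary: h)
    case (Atom q)
    have "consistent \<sigma> (h @ [p])" for p
      using Atom.prems consistent_snoc[OF play_nonempty[OF Atom.prems(1)]]
      by (auto simp: prover_turn_def)
    moreover have "play M w (h @ [(delta M q a, v)])"
      using Atom.prems by (auto intro!: play.step move.intros)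
    ultimately show ?case using outer by auto
  next
    case (And \<phi> \<psi>)
    have "consistent \<sigma> (h @ [p])" for p
      using And.prems consistent_snoc[OF play_nonempty[OF And.prems(1)]]
      by (auto simp: prover_turn_def)
    moreover have "play M w (h @ [(\<phi>, a # v)])" "play M w (h @ [(\<psi>, a # v)])"
      using And.prems by (auto intro!: play.step move.intros)
    ultimately show ?case using And.IH by (auto simp del: accepts_from.simps)
  next
    case (Or \<phi> \<psi>)
    have "move M (last h) (\<sigma> h)"
      using \<sigma> Or.prems by (auto simp: winning_strategy_def prover_turn_def)
    moreover have "play M w (h @ [\<sigma> h])" using Or.prems calculation by (auto intro: play.step)
    moreover have "consistent \<sigma> (h @ [\<sigma> h])"
      using Or.prems consistent_snoc[OF play_nonempty[OF Or.prems(1)]] by auto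
    ultimately show ?case
      using Or.IH[of "h @ [\<sigma> h]"] Or.prems(3) by (auto simp: move.simps simp del: accepts_from.simps)
  qed
qed

lemma accepts_iff_accepts_from: "accepts M w \<longleftrightarrow> accepts_from M w (init M)"
proof
  assume "accepts M w"
  then obtain \<sigma> where "winning_strategy M w \<sigma>" by (auto simp: accepts_def)
  from winning_strategy_pbf_sat[OF this play.start consistent_single, of "Atom (init M)" w]
  show "accepts_from M w (init M)" by simp
next
  assume acc: "accepts_from M w (init M)"
  define good where "good p \<longleftrightarrow> pbf_sat (accepts_from M (snd p)) (fst p)" for p
  \<comment> \<open>A positional strategy: Prover looks only at the last position and moves to a
    successor whose value is true.\<close>
  define \<sigma> where "\<sigma> h = (SOME p. move M (last h) p \<and> good p)" for h
  have \<sigma>: "move M (last h) (\<sigma> h) \<and> good (\<sigma> h)" if g: "good (last h)" and t: "prover_turn (last h)" for h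
  proof -
    obtain \<phi> \<psi> v where l: "last h = (Or \<phi> \<psi>, v)"
      using t by (cases "last h") (auto simp: prover_turn_def)
    then have "good (\<phi>, v) \<or> good (\<psi>, v)" using g by (simp add: good_def)
    then have "\<exists>p. move M (last h) p \<and> good p" unfolding l by (blast intro: move.intros)
    then show ?thesis unfolding \<sigma>_def by (rule someI_ex)
  qed
  have good: "good (last h)" if "play M w h" "consistent \<sigma> h" for h
    using that
  proof (induction rule: play.induct)
    case start
    then show ?case using acc by (simp add: good_def)
  next
    case (step h p)
    have c: "consistent \<sigma> h" "prover_turn (last h) \<Longrightarrow> p = \<sigma> h"
      using step.prems consistent_snoc[OF play_nonempty[OF step.hyps(1)]] by auto
    have "good p"
    proof (cases "prover_turn (last h)")
      case True
      then show ?thesis using \<sigma> step.IH c by auto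
    next
      case False
      \<comment> \<open>Outside Prover's turns every move preserves the value: both conjuncts of a
        true \<open>And\<close> are true, and reading a letter unfolds
        \<open>accepts_from\<close>.\<close>
      with step.hyps(2) step.IH[OF c(1)] show ?thesis
        by (cases rule: move.cases) (auto simp: good_def prover_turn_def)
    qed
    then show ?case by simp
  qed
  have "winning_strategy M w \<sigma>"
    unfolding winning_strategy_def using \<sigma> good by (fastforce simp: good_def)
  then show "accepts M w" by (auto simp: accepts_def)
qed

section \<open>Dependence of acceptance on the states met along a prefix\<close>

lemma pbf_sat_cong: "(\<And>q. q \<in> atoms \<phi> \<Longrightarrow> V q \<longleftrightarrow> W q) \<Longrightarrow> pbf_sat V \<phi> \<longleftrightarrow> pbf_sat W \<phi>"
  by (induction \<phi>) auto

text \<open>Plays are not bound to a strategy, so either branch of a connective may be taken while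
  the unread input stays put.\<close>

lemma play_to_atom:
  assumes "play M w h" "last h = (\<phi>, v)" "q \<in> atoms \<phi>"
  shows "\<exists>h'. play M w h' \<and> last h' = (Atom q, v)"
  using assms
proof (induction \<phi> arbitrary: h)
  case (Atom x)
  then show ?case by auto
next
  case (And \<phi> \<psi>)
  have "play M w (h @ [(\<phi>, v)])" "play M w (h @ [(\<psi>, v)])"
    using And.prems by (auto intro!: play.step move.intros)
  then show ?case using And by auto
next
  case (Or \<phi> \<psi>)
  have "play M w (h @ [(\<phi>, v)])" "play M w (h @ [(\<psi>, v)])"
    using Or.prems by (auto intro!: play.step move.intros)
  then show ?case using Or by auto
qed

text \<open>\<open>h\<close> plays on \<open>u\<close> alone and \<open>v\<close> is the rest of
  \<open>u\<close>. Evaluation through \<open>v\<close> only consults states reached by such plays;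
  those reached with \<open>v\<close> used up appear on \<open>u\<close>, where \<open>w\<close> and
  \<open>w'\<close> agree.\<close>

lemma accepts_from_append_cong:
  assumes eq: "\<And>q. appears M u q \<Longrightarrow> accepts_from M w q \<longleftrightarrow> accepts_from M w' q"
    and "play M u h" "last h = (Atom q, v)"
  shows "accepts_from M (v @ w) q \<longleftrightarrow> accepts_from M (v @ w') q"
  using assms(2,3)
proof (induction v arbitrary: q h)
  case Nil
  then have "appears M u q"
    using last_in_set[OF play_nonempty[OF Nil.prems(1)]] by (auto simp: appears_def)
  then show ?case using eq by simp
next
  case (Cons a v)
  have p: "play M u (h @ [(delta M q a, v)])"
    using Cons.prems by (auto intro!: play.step move.intros)
  show ?case
    using play_to_atom[OF p] Cons.IH by (auto intro!: pbf_sat_cong)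
qed

lemma accepts_append_cong:
  assumes "\<And>q. appears M u q \<Longrightarrow> accepts_from M w q \<longleftrightarrow> accepts_from M w' q"
  shows "accepts M (u @ w) \<longleftrightarrow> accepts M (u @ w')"
  unfolding accepts_iff_accepts_from
  by (rule accepts_from_append_cong[OF assms play.start]) simp_all

section \<open>Counting states\<close>

text \<open>If continuations cut every subset out of \<open>V\<close>, then \<open>U\<close> can be
  recovered from its profile \<open>Q U\<close>, so the \<open>2 ^ card V\<close> subsets need as
  many sets of states; comparing powers of 2 gives the bound.\<close>

lemma card_le_states_upto:
  assumes A: "V \<subseteq> lists A" "\<And>u. u \<in> V \<Longrightarrow> length u \<le> n"
    and w: "\<And>U. U \<subseteq> V \<Longrightarrow> w U \<in> lists A"
    and sep: "\<And>U u. U \<subseteq> V \<Longrightarrow> u \<in> V \<Longrightarrow> u @ w U \<in> language A M \<longleftrightarrow> u \<in> U"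
    and fin: "finite V" "finite (states_upto A M n)"
  shows "card V \<le> card (states_upto A M n)"
proof -
  define Q where "Q U = {q \<in> states_upto A M n. accepts_from M (w U) q}" for U
  have "inj_on Q (Pow V)"
  proof (rule inj_onI)
    fix U U' assume U: "U \<in> Pow V" "U' \<in> Pow V" and eq: "Q U = Q U'"
    have "u \<in> U \<longleftrightarrow> u \<in> U'" if u: "u \<in> V" for u
    proof -
      have "accepts_from M (w U) q \<longleftrightarrow> accepts_from M (w U') q" if "appears M u q" for q
      proof -
        have "q \<in> states_upto A M n" using A u that by (auto simp: states_upto_def)
        then show ?thesis using eq by (auto simp: Q_def)
      qed
      then have "accepts M (u @ w U) \<longleftrightarrow> accepts M (u @ w U')" by (rule accepts_append_cong)
      moreover have "u @ w U \<in> lists A" "u @ w U' \<in> lists A"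
        using A u U w by auto
      ultimately show ?thesis
        using sep[of U u] sep[of U' u] u U by (simp add: language_def)
    qed
    then show "U = U'" using U by blast
  qed
  moreover have "Q ` Pow V \<subseteq> Pow (states_upto A M n)" by (auto simp: Q_def)
  ultimately have "card (Pow V) \<le> card (Pow (states_upto A M n))"
    using fin by (meson card_inj_on_le finite_Pow_iff)
  then show ?thesis using fin by (simp add: card_Pow)
qed

section \<open>The witness language\<close>

text \<open>\<open>x\<close> and \<open>y\<close> may contain further separators 2, so the mirrored
  copy of \<open>u\<close> may sit in any block of the continuation; the reversal keeps the language
  context-free.\<close>

definition hard_lang :: "nat list set" where
  "hard_lang = {u @ 2 # x @ rev u @ 2 # y |u x y.
     u \<in> lists {0, 1} \<and> x \<in> lists {0, 1, 2} \<and> y \<in> lists {0, 1, 2}}"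

text \<open>The terminator follows every block, the last one included, so that each of them can
  serve as the factor \<open>rev u @ [2]\<close> in \<open>hard_lang\<close>.\<close>

definition blocks :: "nat list list \<Rightarrow> nat list" where
  "blocks us = concat (map (\<lambda>u. rev u @ [2]) us)"

lemma append_Cons_eq_first:
  assumes "a \<notin> set xs" "a \<notin> set xs'"
  shows "xs @ a # ys = xs' @ a # ys' \<longleftrightarrow> xs = xs' \<and> ys = ys'"
  using assms
proof (induction xs arbitrary: xs')
  case Nil
  then show ?case by (cases xs') auto
next
  case (Cons b xs)
  then show ?case by (cases xs') auto
qed

text \<open>Induction on the blocks: if \<open>x\<close> contains a 2, the first block lies inside
  \<open>x\<close> and is dropped. Otherwise \<open>x @ rev u\<close> is the first block, and equal
  lengths force \<open>x\<close> to be empty.\<close>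

lemma block_mem:
  assumes "blocks us = x @ rev u @ 2 # y" "2 \<notin> set u"
    and "\<And>v. v \<in> set us \<Longrightarrow> length v = length u \<and> 2 \<notin> set v"
  shows "u \<in> set us"
  using assms
proof (induction us arbitrary: x)
  case Nil
  then show ?case by (simp add: blocks_def)
next
  case (Cons v vs)
  have v: "2 \<notin> set (rev v)" "length v = length u" using Cons.prems by auto
  have e: "rev v @ 2 # blocks vs = x @ rev u @ 2 # y"
    using Cons.prems(1) by (simp add: blocks_def)
  show ?case
  proof (cases "2 \<in> set x")
    case False
    then have "rev v = x @ rev u"
      using e v Cons.prems(2) append_Cons_eq_first[of 2 "rev v" "x @ rev u" "blocks vs" y] by auto
    then have "rev v = rev u" using v by (metis append_eq_append_conv append_Nil length_rev)
    then show ?thesis by simp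
  next
    case True
    then obtain x1 x2 where x: "x = x1 @ 2 # x2" "2 \<notin> set x1" by (metis split_list_first)
    then have "blocks vs = x2 @ rev u @ 2 # y"
      using e v append_Cons_eq_first[of 2 "rev v" x1 "blocks vs" "x2 @ rev u @ 2 # y"] by simp
    then show ?thesis using Cons by auto
  qed
qed

lemma blocks_in_lists: "set us \<subseteq> lists {0, 1} \<Longrightarrow> blocks us \<in> lists {0, 1, 2}"
  by (induction us) (auto simp: blocks_def)

text \<open>As \<open>u\<close> contains no 2, the first separator marks its end, so any
  decomposition in \<open>hard_lang\<close> starts with the same \<open>u\<close>.\<close>

lemma append_blocks_in_hard_lang_iff:
  assumes us: "\<And>v. v \<in> set us \<Longrightarrow> length v = length u \<and> v \<in> lists {0, 1}"
    and u: "u \<in> lists {0, 1}"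
  shows "u @ 2 # blocks us \<in> hard_lang \<longleftrightarrow> u \<in> set us"
proof
  have no2: "2 \<notin> set v" if "v \<in> lists {0, 1}" for v :: "nat list"
    using that by fastforce
  assume "u @ 2 # blocks us \<in> hard_lang"
  then obtain u' x y where e: "u @ 2 # blocks us = u' @ 2 # x @ rev u' @ 2 # y"
    and u': "u' \<in> lists {0, 1}" unfolding hard_lang_def by blast
  have "u = u' \<and> blocks us = x @ rev u' @ 2 # y"
    using e no2[OF u] no2[OF u'] append_Cons_eq_first[of 2 u u' "blocks us" "x @ rev u' @ 2 # y"] by simp
  then show "u \<in> set us" using block_mem[of us x u y] us u no2 by auto
next
  assume "u \<in> set us"
  then obtain us1 us2 where s: "us = us1 @ u # us2" by (metis split_list)
  then have "u @ 2 # blocks us = u @ 2 # blocks us1 @ rev u @ 2 # blocks us2"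
    by (simp add: blocks_def)
  moreover have "set us1 \<subseteq> lists {0, 1}" "set us2 \<subseteq> lists {0, 1}"
    using us unfolding s set_append list.set by blast+
  then have "blocks us1 \<in> lists {0, 1, 2}" "blocks us2 \<in> lists {0, 1, 2}"
    using blocks_in_lists by blast+
  ultimately show "u @ 2 # blocks us \<in> hard_lang"
    using u unfolding hard_lang_def
    by (intro CollectI exI[of _ u] exI[of _ "blocks us1"] exI[of _ "blocks us2"] conjI)
qed

section \<open>Exponential lower bound on the number of states\<close>

lemma hard_lang_not_in_Alt:
  fixes f :: "nat \<Rightarrow> nat"
  assumes f: "(\<lambda>n. real (f n)) \<in> o(\<lambda>n. 2 ^ n)"
  shows "hard_lang \<notin> Alt {0, 1, 2} f"
proof
  assume "hard_lang \<in> Alt {0, 1, 2} f"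
  then obtain M :: "(nat, nat) alt_machine" and C :: real
    where L: "language {0, 1, 2} M = hard_lang"
      and fin: "\<And>n. finite (states_upto {0, 1, 2} M n)"
      and C: "\<And>n. real (card (states_upto {0, 1, 2} M n)) \<le> C * real (f n)"
    by (auto simp: Alt_def states_bounded_def)
  have lower: "2 ^ n \<le> C * real (f n)" for n
  proof -
    \<comment> \<open>All \<open>2 ^ n\<close> binary words of length \<open>n\<close>; each subset
      is cut out by a list of its blocks.\<close>
    define V where "V = {u :: nat list. set u \<subseteq> {0, 1} \<and> length u = n}"
    have V: "finite V" "card V = 2 ^ n"
      unfolding V_def by (simp_all add: finite_lists_length_eq card_lists_length_eq numeral_2_eq_2)
    have "\<exists>us. set us = U" if "U \<subseteq> V" for U
      using finite_list finite_subset[OF that V(1)] by blast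
    then obtain g where g: "\<And>U. U \<subseteq> V \<Longrightarrow> set (g U) = U" by metis
    have "card V \<le> card (states_upto {0, 1, 2} M n)"
    proof (rule card_le_states_upto[where w = "\<lambda>U. 2 # blocks (g U)"])
      show "2 # blocks (g U) \<in> lists {0, 1, 2}" if "U \<subseteq> V" for U
      proof -
        have "set (g U) \<subseteq> lists {0, 1}" using g[OF that] that by (auto simp: V_def)
        then show ?thesis using blocks_in_lists by auto
      qed
      show "u @ 2 # blocks (g U) \<in> language {0, 1, 2} M \<longleftrightarrow> u \<in> U"
        if "U \<subseteq> V" "u \<in> V" for U u
        unfolding L using append_blocks_in_hard_lang_iff[of "g U" u] g[OF that(1)] that
        by (auto simp: V_def)
    qed (use V fin in \<open>auto simp: V_def\<close>)
    then show ?thesis using V C[of n] by (metis of_nat_le_iff of_nat_numeral of_nat_power order_trans)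
  qed
  \<comment> \<open>With \<open>\<bar>C\<bar> + 1\<close> in place of \<open>C\<close>, which may
    have any sign, this factor makes \<open>C * f n\<close> at most half of
    \<open>2 ^ n\<close>.\<close>
  have "eventually (\<lambda>n. norm (real (f n)) \<le> 1 / (2 * (\<bar>C\<bar> + 1)) * norm (2 ^ n :: real)) sequentially"
    using f by (rule landau_o.smallD) auto
  then obtain n where n: "real (f n) \<le> 1 / (2 * (\<bar>C\<bar> + 1)) * 2 ^ n"
    by (auto simp: eventually_sequentially)
  have "C * real (f n) \<le> (\<bar>C\<bar> + 1) * real (f n)" by (intro mult_right_mono) auto
  also have "\<dots> \<le> (\<bar>C\<bar> + 1) * (1 / (2 * (\<bar>C\<bar> + 1)) * 2 ^ n)" by (intro mult_left_mono n) auto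
  also have "\<dots> = 2 ^ n / 2" by (simp add: field_simps)
  also have "\<dots> < 2 ^ n" by simp
  finally show False using lower[of n] by simp
qed

section \<open>Context-freeness\<close>

lemma derives_context:
  assumes "(derives1 P)\<^sup>*\<^sup>* \<alpha> \<beta>"
  shows "(derives1 P)\<^sup>*\<^sup>* (u @ \<alpha> @ v) (u @ \<beta> @ v)"
  using assms
proof induction
  case (step \<beta> \<gamma>)
  have "derives1 P (u @ \<beta> @ v) (u @ \<gamma> @ v)"
    using step.hyps(2)
  proof cases
    case (1 X \<delta> u' v')
    then show ?thesis using derives1.intros[of X \<delta> P "u @ u'" "v' @ v"] by simp
  qed
  then show ?case using step.IH by (simp add: rtranclp.rtrancl_into_rtrancl)
qed simp

lemma derives_production:
  assumes "(X, u @ \<alpha> @ v) \<in> P" "(derives1 P)\<^sup>*\<^sup>* \<alpha> \<beta>"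
  shows "(derives1 P)\<^sup>*\<^sup>* [NT X] (u @ \<beta> @ v)"
proof (rule converse_rtranclp_into_rtranclp)
  show "derives1 P [NT X] (u @ \<alpha> @ v)"
    using derives1.intros[OF assms(1), of "[]" "[]"] by simp
  show "(derives1 P)\<^sup>*\<^sup>* (u @ \<alpha> @ v) (u @ \<beta> @ v)"
    by (rule derives_context[OF assms(2)])
qed

lemma derives_append:
  assumes "(derives1 P)\<^sup>*\<^sup>* \<alpha> \<alpha>'" "(derives1 P)\<^sup>*\<^sup>* \<beta> \<beta>'"
  shows "(derives1 P)\<^sup>*\<^sup>* (\<alpha> @ \<beta>) (\<alpha>' @ \<beta>')"
proof (rule rtranclp_trans)
  show "(derives1 P)\<^sup>*\<^sup>* (\<alpha> @ \<beta>) (\<alpha>' @ \<beta>)"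
    using derives_context[OF assms(1), of "[]" \<beta>] by simp
  show "(derives1 P)\<^sup>*\<^sup>* (\<alpha>' @ \<beta>) (\<alpha>' @ \<beta>')"
    using derives_context[OF assms(2), of \<alpha>' "[]"] by simp
qed

section \<open>Upper bounds on generated languages\<close>

fun form_lang :: "('n \<Rightarrow> 't list set) \<Rightarrow> ('n, 't) symbol list \<Rightarrow> 't list set" where
  "form_lang I [] = {[]}"
| "form_lang I (T a # \<alpha>) = (#) a ` form_lang I \<alpha>"
| "form_lang I (NT X # \<alpha>) = {v @ w |v w. v \<in> I X \<and> w \<in> form_lang I \<alpha>}"

lemma form_lang_append:
  "form_lang I (\<alpha> @ \<beta>) = {v @ w |v w. v \<in> form_lang I \<alpha> \<and> w \<in> form_lang I \<beta>}"
proof (induction I \<alpha> rule: form_lang.induct)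
  case (2 I a \<alpha>)
  show ?case
  proof (intro equalityI subsetI)
    fix z assume "z \<in> form_lang I ((T a # \<alpha>) @ \<beta>)"
    then obtain v w where z: "z = (a # v) @ w" and "v \<in> form_lang I \<alpha>" "w \<in> form_lang I \<beta>"
      using 2 by auto
    then have "a # v \<in> form_lang I (T a # \<alpha>) \<and> w \<in> form_lang I \<beta>" by simp
    with z show "z \<in> {v @ w |v w. v \<in> form_lang I (T a # \<alpha>) \<and> w \<in> form_lang I \<beta>}" by blast
  next
    fix z assume "z \<in> {v @ w |v w. v \<in> form_lang I (T a # \<alpha>) \<and> w \<in> form_lang I \<beta>}"
    then obtain v w where "z = a # v @ w" "v \<in> form_lang I \<alpha>" "w \<in> form_lang I \<beta>"
      by auto
    then show "z \<in> form_lang I ((T a # \<alpha>) @ \<beta>)" using 2 by auto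
  qed
next
  case (3 I X \<alpha>)
  show ?case
  proof (intro equalityI subsetI)
    fix z assume "z \<in> form_lang I ((NT X # \<alpha>) @ \<beta>)"
    then obtain u v w where z: "z = (u @ v) @ w"
      and "u \<in> I X" "v \<in> form_lang I \<alpha>" "w \<in> form_lang I \<beta>"
      using 3 by auto
    then have "u @ v \<in> form_lang I (NT X # \<alpha>) \<and> w \<in> form_lang I \<beta>" by auto
    with z show "z \<in> {v @ w |v w. v \<in> form_lang I (NT X # \<alpha>) \<and> w \<in> form_lang I \<beta>}" by blast
  next
    fix z assume "z \<in> {v @ w |v w. v \<in> form_lang I (NT X # \<alpha>) \<and> w \<in> form_lang I \<beta>}"
    then obtain u v w where "z = u @ v @ w" "u \<in> I X" "v \<in> form_lang I \<alpha>" "w \<in> form_lang I \<beta>"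
      by auto
    then show "z \<in> form_lang I ((NT X # \<alpha>) @ \<beta>)" using 3 by auto
  qed
qed simp

lemma form_lang_map_T: "form_lang I (map T w) = {w}"
  by (induction w) auto

text \<open>\<open>I\<close> is a pre-fixed point of the productions, so a rewriting step can only
  shrink the language denoted by a sentential form; a terminal word denotes just itself.\<close>

lemma grammar_language_subset:
  assumes "\<And>X \<alpha>. (X, \<alpha>) \<in> P \<Longrightarrow> form_lang I \<alpha> \<subseteq> I X"
  shows "grammar_language P S \<subseteq> I S"
proof -
  have "form_lang I \<beta> \<subseteq> form_lang I \<alpha>" if "(derives1 P)\<^sup>*\<^sup>* \<alpha> \<beta>" for \<alpha> \<beta>
    using that
  proof induction
    case (step \<beta> \<gamma>)
    from step.hyps(2) have "form_lang I \<gamma> \<subseteq> form_lang I \<beta>"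
    proof cases
      case (1 X \<delta> u v)
      then show ?thesis using assms by (fastforce simp: form_lang_append)
    qed
    then show ?case using step.IH by blast
  qed simp
  from this[of "[NT S]"] show ?thesis
    by (fastforce simp: grammar_language_def form_lang_map_T)
qed

section \<open>A grammar for the witness language\<close>

text \<open>Nonterminal 0 is the start, 1 generates the words \<open>u @ 2 # x @ rev u\<close>, and
  2 generates all words over the alphabet.\<close>

definition hard_prods :: "(nat \<times> (nat, nat) symbol list) set" where
  "hard_prods = {(0, [NT 1, T 2, NT 2]),
     (1, [T 0, NT 1, T 0]), (1, [T 1, NT 1, T 1]), (1, [T 2, NT 2]),
     (2, []), (2, [T 0, NT 2]), (2, [T 1, NT 2]), (2, [T 2, NT 2])}"

lemma derives_any:
  "x \<in> lists {0, 1, 2} \<Longrightarrow> (derives1 hard_prods)\<^sup>*\<^sup>* [NT 2] (map T x)"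
proof (induction x)
  case Nil
  then show ?case using derives_production[of 2 "[]" "[]" "[]" hard_prods "[]"]
    by (simp add: hard_prods_def)
next
  case (Cons a x)
  then have "(2, [T a] @ [NT 2] @ []) \<in> hard_prods" by (auto simp: hard_prods_def)
  from derives_production[OF this, of "map T x"] Cons show ?case by simp
qed

lemma derives_mirror:
  assumes "x \<in> lists {0, 1, 2}"
  shows "u \<in> lists {0, 1} \<Longrightarrow> (derives1 hard_prods)\<^sup>*\<^sup>* [NT 1] (map T (u @ 2 # x @ rev u))"
proof (induction u)
  case Nil
  have "(1, [T 2] @ [NT 2] @ []) \<in> hard_prods" by (auto simp: hard_prods_def)
  from derives_production[OF this derives_any[OF assms]] show ?case by simp
next
  case (Cons a u)
  then have "(1, [T a] @ [NT 1] @ [T a]) \<in> hard_prods" by (auto simp: hard_prods_def)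
  from derives_production[OF this, of "map T (u @ 2 # x @ rev u)"] Cons show ?case by simp
qed

lemma hard_lang_grammar: "grammar_language hard_prods 0 = hard_lang"
proof
  define N where "N = {u @ 2 # x @ rev u |u x :: nat list. u \<in> lists {0, 1} \<and> x \<in> lists {0, 1, 2}}"
  \<comment> \<open>The intended languages of the three nonterminals, shown below to be closed under
    the productions.\<close>
  define I where
    "I X = (if X = (0::nat) then hard_lang else if X = 1 then N else lists {0, 1, 2})" for X
  have N_Cons: "a # v @ [a] \<in> N" if v: "v \<in> N" and a: "a \<in> {0, 1}" for a v
  proof -
    obtain u x where "v = u @ 2 # x @ rev u" "u \<in> lists {0, 1}" "x \<in> lists {0, 1, 2}"
      using v unfolding N_def by blast
    then have "a # v @ [a] = (a # u) @ 2 # x @ rev (a # u)" "a # u \<in> lists {0, 1}"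
      using a by auto
    then show ?thesis using \<open>x \<in> lists {0, 1, 2}\<close> unfolding N_def by blast
  qed
  have N_base: "2 # x \<in> N" if "x \<in> lists {0, 1, 2}" for x
  proof -
    have "2 # x = [] @ 2 # x @ rev []" "[] \<in> lists {0, 1::nat}" by auto
    then show ?thesis using that unfolding N_def by blast
  qed
  have N_L: "v @ 2 # y \<in> hard_lang" if "v \<in> N" "y \<in> lists {0, 1, 2}" for v y
    using that unfolding N_def hard_lang_def by fastforce
  have "form_lang I \<alpha> \<subseteq> I X" if "(X, \<alpha>) \<in> hard_prods" for X \<alpha>
    using that N_Cons N_base N_L by (auto simp: hard_prods_def I_def del: in_listsI in_listsD)
  from grammar_language_subset[of hard_prods I 0, OF this]
  show "grammar_language hard_prods 0 \<subseteq> hard_lang" by (simp add: I_def)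
  show "hard_lang \<subseteq> grammar_language hard_prods 0"
  proof
    fix w assume "w \<in> hard_lang"
    then obtain u x y where w: "w = (u @ 2 # x @ rev u) @ [2] @ y"
      and uxy: "u \<in> lists {0, 1}" "x \<in> lists {0, 1, 2}" "y \<in> lists {0, 1, 2}"
      unfolding hard_lang_def by auto
    \<comment> \<open>The three factors of \<open>w\<close> match the three symbols of the start
      production and are derived independently.\<close>
    have "(derives1 hard_prods)\<^sup>*\<^sup>* ([NT 1] @ [T 2] @ [NT 2]) (map T w)"
      unfolding w map_append[of _ _ "_ @ _"] map_append[of _ "[2]"]
      by (intro derives_append derives_mirror derives_any uxy) simp
    then have "(derives1 hard_prods)\<^sup>*\<^sup>* [NT 0] (map T w)"
      using derives_production[of 0 "[]" "[NT 1, T 2, NT 2]" "[]" hard_prods "map T w"]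
      by (simp add: hard_prods_def)
    then show "w \<in> grammar_language hard_prods 0" by (simp add: grammar_language_def)
  qed
qed

lemma context_free_hard_lang: "context_free {0, 1, 2} hard_lang"
  unfolding context_free_def hard_lang_grammar[symmetric]
  by (intro exI[of _ hard_prods] exI[of _ 0]) (auto simp: hard_prods_def)

section \<open>Presburger definability\<close>

text \<open>\<open>k\<close> is the position of the first 2 and \<open>Suc t\<close> that of the 2
  ending the mirrored copy. Since \<open>u\<close> starts at 0, mirrored positions sum to
  \<open>t\<close>, and \<open>k + k \<le> t\<close> keeps \<open>rev u\<close> to the right of
  position \<open>k\<close>.\<close>

lemma hard_lang_iff_positions:
  assumes w: "w \<in> lists {0, 1, 2}"
  shows "w \<in> hard_lang \<longleftrightarrow> (\<exists>k t. Suc t < length w \<and> k + k \<le> t \<and> w ! k = 2 \<and> w ! Suc t = 2 \<and>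
    (\<forall>j<k. w ! j \<in> {0, 1} \<and> w ! (t - j) = w ! j))"
    (is "_ \<longleftrightarrow> (\<exists>k t. ?R k t)")
proof
  assume "w \<in> hard_lang"
  then obtain u x y where e: "w = u @ 2 # x @ rev u @ 2 # y" and u: "u \<in> lists {0, 1}"
    unfolding hard_lang_def by blast
  define k where "k = length u"
  define t where "t = k + length x + k"
  have "w ! Suc t = 2" by (simp add: e t_def k_def nth_append)
  moreover have "w ! k = 2" by (simp add: e k_def)
  moreover have "w ! j \<in> {0, 1} \<and> w ! (t - j) = w ! j" if j: "j < k" for j
  proof -
    have "w ! j = u ! j" using j by (simp add: e k_def nth_append)
    moreover have "w ! (t - j) = rev u ! (k - Suc j)"
    proof -
      have "w = (u @ 2 # x) @ rev u @ 2 # y" by (simp add: e)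
      moreover have "t - j = length (u @ 2 # x) + (k - Suc j)" using j by (simp add: t_def k_def)
      ultimately have "w ! (t - j) = (rev u @ 2 # y) ! (k - Suc j)"
        by (metis nth_append_length_plus)
      moreover have "k - Suc j < length (rev u)" using j by (simp add: k_def)
      ultimately show ?thesis by (simp add: nth_append)
    qed
    moreover have "rev u ! (k - Suc j) = u ! j" using j by (simp add: k_def rev_nth)
    moreover have "u ! j \<in> {0, 1}" using j u nth_mem[of j u] by (fastforce simp: k_def)
    ultimately show ?thesis by simp
  qed
  moreover have "Suc t < length w" "k + k \<le> t" by (simp_all add: e t_def k_def)
  ultimately show "\<exists>k t. ?R k t" by blast
next
  assume "\<exists>k t. ?R k t"
  then obtain k t where R: "?R k t" by blast
  \<comment> \<open>The prefix ending with the mirrored copy; with \<open>u\<close> and its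
    separator removed, \<open>r\<close> is \<open>x\<close>, of length \<open>t - k - k\<close>,
    followed by \<open>rev u\<close>.\<close>
  define v where "v = take (Suc t) w"
  define u where "u = take k w"
  define r where "r = drop (Suc k) v"
  have "w = v @ 2 # drop (Suc (Suc t)) w" using R id_take_nth_drop[of "Suc t" w] by (simp add: v_def)
  moreover have "v = u @ 2 # r"
    using R id_take_nth_drop[of k v] by (simp add: v_def u_def r_def)
  moreover have "drop (t - k - k) r = rev u"
  proof (rule nth_equalityI)
    show len: "length (drop (t - k - k) r) = length (rev u)"
      using R by (auto simp: r_def v_def u_def)
    fix i assume "i < length (drop (t - k - k) r)"
    then have i: "i < k" using len R by (simp add: u_def)
    then have "k - Suc i < k" by simp
    then have "w ! (t - (k - Suc i)) = w ! (k - Suc i)" using R by blast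
    \<comment> \<open>The same position counted by mirroring and from the start of \<open>v\<close>,
      past \<open>u\<close>, its separator and \<open>x\<close>.\<close>
    moreover have "t - (k - Suc i) = Suc k + (t - k - k + i)" "Suc k + (t - k - k + i) < Suc t"
      using i R by linarith+
    moreover have "drop (t - k - k) r ! i = v ! (Suc k + (t - k - k + i))"
      using R unfolding r_def by (subst nth_drop nth_drop; simp add: v_def)+
    moreover have "rev u ! i = w ! (k - Suc i)" using i R by (simp add: u_def rev_nth)
    ultimately show "drop (t - k - k) r ! i = rev u ! i" unfolding v_def by (metis nth_take)
  qed
  then have "r = take (t - k - k) r @ rev u" by (metis append_take_drop_id)
  ultimately have "w = u @ 2 # take (t - k - k) r @ rev u @ 2 # drop (Suc (Suc t)) w"
    by (metis append.assoc append_Cons)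
  moreover have "\<forall>j<k. w ! j \<in> {0, 1}" using R by blast
  then have "u \<in> lists {0, 1}" by (fastforce simp: u_def in_set_conv_nth)
  moreover have "take (t - k - k) r \<in> lists {0, 1, 2}" "drop (Suc (Suc t)) w \<in> lists {0, 1, 2}"
    using w by (auto simp: r_def v_def dest!: in_set_takeD in_set_dropD)
  ultimately show "w \<in> hard_lang" unfolding hard_lang_def by blast
qed

text \<open>The variables 0, 1, 2, 3 stand for \<open>k\<close>, \<open>t\<close>, \<open>k + k\<close> and \<open>t + 1\<close> of
  \<open>hard_lang_iff_positions\<close>, and 5, 6 for \<open>j\<close> and \<open>t - j\<close>.\<close>

definition hard_formula :: "nat formula" where
  "hard_formula =
     Ex 0 (Ex 1 (Ex 2 (Ex 3
       (Conj (Conj (Sum 0 0 2) (Neg (Less 1 2)))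
       (Conj (Conj (Less 1 3) (Neg (Ex 4 (Conj (Less 1 4) (Less 4 3)))))
       (Conj (Conj (Letter 2 0) (Letter 2 3))
         (Neg (Ex 5 (Conj (Less 5 0) (Neg (Ex 6 (Conj (Sum 5 6 1)
           (Neg (Conj (Neg (Conj (Letter 0 5) (Letter 0 6)))
                      (Neg (Conj (Letter 1 5) (Letter 1 6)))))))))))))))))"

text \<open>Quantifiers reach positions only, so the work is to see that \<open>k + k\<close>,
  \<open>Suc t\<close> and \<open>t - j\<close> are positions; the bounds on \<open>k\<close> and
  \<open>t\<close> give this.\<close>

lemma holds_hard_formula:
  "holds w e hard_formula \<longleftrightarrow>
     (\<exists>k t. Suc t < length w \<and> k + k \<le> t \<and> w ! k = 2 \<and> w ! Suc t = 2 \<and>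
        (\<forall>j<k. w ! j \<in> {0, 1} \<and> w ! (t - j) = w ! j))"
    (is "_ \<longleftrightarrow> (\<exists>k t. ?R k t)")
proof -
  let ?n = "length w"
  \<comment> \<open>The mirror condition at \<open>j\<close>: some \<open>i\<close> with
    \<open>j + i = t\<close> carries the same letter, 0 or 1, written with negation and conjunction
    only.\<close>
  define E where "E t j \<longleftrightarrow> (\<exists>i<?n. j + i = t \<and>
      \<not> (\<not> ((j < ?n \<and> w ! j = 0) \<and> (i < ?n \<and> w ! i = 0)) \<and>
         \<not> ((j < ?n \<and> w ! j = 1) \<and> (i < ?n \<and> w ! i = 1))))" for t j
  define M where "M k t \<longleftrightarrow> \<not> (\<exists>j<?n. j < k \<and> \<not> E t j)" for k t
  have holds: "holds w e hard_formula \<longleftrightarrow> (\<exists>k<?n. \<exists>t<?n. \<exists>s<?n. \<exists>z<?n.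
      (k + k = s \<and> \<not> t < s) \<and> (t < z \<and> \<not> (\<exists>y<?n. t < y \<and> y < z)) \<and>
      ((k < ?n \<and> w ! k = 2) \<and> (z < ?n \<and> w ! z = 2)) \<and> M k t)"
    by (simp add: hard_formula_def M_def E_def)
  have M: "M k t \<longleftrightarrow> (\<forall>j<k. w ! j \<in> {0, 1} \<and> w ! (t - j) = w ! j)" if "k + k \<le> t" "t < ?n" for k t
  proof -
    have E: "E t j \<longleftrightarrow> w ! j \<in> {0, 1} \<and> w ! (t - j) = w ! j" and lt: "j < ?n"
      if j: "j < k" for j
    proof -
      \<comment> \<open>As \<open>j < k\<close> and \<open>k + k \<le> t\<close>, the subtraction
        \<open>t - j\<close> is not truncated, and it is the only candidate for
        \<open>i\<close>.\<close>
      have le: "t - j < ?n" "j < ?n" "j + (t - j) = t"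
        using j \<open>k + k \<le> t\<close> \<open>t < ?n\<close> by linarith+
      have ex: "(\<exists>i<?n. j + i = t \<and> P i) \<longleftrightarrow> P (t - j)" for P
      proof
        assume "\<exists>i<?n. j + i = t \<and> P i"
        then obtain i where "j + i = t" "P i" by blast
        then show "P (t - j)" by auto
      next
        assume "P (t - j)"
        then show "\<exists>i<?n. j + i = t \<and> P i" using le by blast
      qed
      show "E t j \<longleftrightarrow> w ! j \<in> {0, 1} \<and> w ! (t - j) = w ! j"
        unfolding E_def ex using le(1,2) by auto
      show "j < ?n" by (rule le(2))
    qed
    have "M k t \<longleftrightarrow> (\<forall>j<k. E t j)" unfolding M_def using lt by blast
    then show ?thesis using E by simp
  qed
  show ?thesis
  proof
    assume "holds w e hard_formula"
    then obtain k t z where kt: "t < ?n" "z < ?n" "k + k \<le> t" "t < z" "w ! k = 2" "w ! z = 2" "M k t"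
      and y: "\<not> (\<exists>y<?n. t < y \<and> y < z)"
      unfolding holds not_less by blast
    \<comment> \<open>Otherwise \<open>Suc t\<close> itself would lie strictly between
      \<open>t\<close> and \<open>z\<close>.\<close>
    have "\<not> Suc t < z" using y kt(2) by (meson lessI less_trans)
    then have "z = Suc t" using kt(4) by linarith
    then show "\<exists>k t. ?R k t" using kt M[of k t] by blast
  next
    assume "\<exists>k t. ?R k t"
    then obtain k t where R: "?R k t" by blast
    then have "M k t" using M[of k t] by simp
    moreover have "k < ?n" "t < ?n" "k + k < ?n" "Suc t < ?n" "\<not> t < k + k" "t < Suc t"
      "\<not> (\<exists>y<?n. t < y \<and> y < Suc t)" "w ! k = 2" "w ! Suc t = 2"
      using R by simp_all
    ultimately show "holds w e hard_formula" unfolding holds by blast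
  qed
qed

lemma presburger_definable_hard_lang: "presburger_definable {0, 1, 2} hard_lang"
proof -
  have "hard_lang \<subseteq> lists {0, 1, 2}" unfolding hard_lang_def by fastforce
  then have "hard_lang = {w \<in> lists {0, 1, 2}. holds w (\<lambda>_. 0) hard_formula}"
    using hard_lang_iff_positions unfolding holds_hard_formula by blast
  moreover have "free_vars hard_formula = {}" by (auto simp: hard_formula_def)
  ultimately show ?thesis unfolding presburger_definable_def by blast
qed

theorem theorem4:
  shows "\<exists>(A :: nat set) (L :: nat list set).
           finite A \<and> L \<subseteq> lists A \<and>
           context_free A L \<and> presburger_definable A L \<and>
           (\<forall>f :: nat \<Rightarrow> nat.
              (\<forall>C :: real. C > 1 \<longrightarrow> (\<lambda>n. real (f n)) \<in> o(\<lambda>n. C ^ n)) \<longrightarrow> L \<notin> Alt A f)"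
proof (intro exI conjI)
  show "finite {0, 1, 2 :: nat}" by simp
  show "hard_lang \<subseteq> lists {0, 1, 2}" unfolding hard_lang_def by fastforce
  show "context_free {0, 1, 2} hard_lang" by (rule context_free_hard_lang)
  show "presburger_definable {0, 1, 2} hard_lang" by (rule presburger_definable_hard_lang)
  show "\<forall>f. (\<forall>C :: real. C > 1 \<longrightarrow> (\<lambda>n. real (f n)) \<in> o(\<lambda>n. C ^ n)) \<longrightarrow>
      hard_lang \<notin> Alt {0, 1, 2} f"
  proof (intro allI impI)
    fix f :: "nat \<Rightarrow> nat"
    assume "\<forall>C :: real. C > 1 \<longrightarrow> (\<lambda>n. real (f n)) \<in> o(\<lambda>n. C ^ n)"
    \<comment> \<open>Base 2 is the rate at which the number of binary words grows with their
      length.\<close>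
    then have "(\<lambda>n. real (f n)) \<in> o(\<lambda>n. 2 ^ n)" by (elim allE[of _ 2]) simp
    then show "hard_lang \<notin> Alt {0, 1, 2} f" by (rule hard_lang_not_in_Alt)
  qed
qed

end
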